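(* Every graph $G$ is $\lfloor \frac{3}{4}\operatorname{mad}(G)+1\rfloor$-choosable with defect $1$, and thus with clustering $2$.
   Context: Graphs are finite and simple. $\operatorname{mad}(G)$ is the maximum, over all subgraphs $H$ of $G$, of the average degree of $H$. In a coloured graph the monochromatic subgraph is the spanning subgraph of edges whose endpoints have the same colour; its connected components are monochromatic components. A colouring has defect $d$ if the monochromatic subgraph has maximum degree at most $d$, and has clustering $c$ if every monochromatic component has at most $c$ vertices. A $k$-list-assignment $L$ assigns to each vertex $v$ a set $L(v)$ of at least $k$ colours; an $L$-colouring colours each $v$ with a colour from $L(v)$. $G$ is $k$-choosable with defect $d$ (resp. clustering $c$) if for every $k$-list-assignment $L$, $G$ has an $L$-colouring with defect $d$ (resp. clustering $c$). *)

theory Defs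
  imports Complex_Main "Graph_Theory.Digraph_Component"
begin

text \<open>
  A finite simple graph is a \<open>pair_graph\<close>: a finite, symmetric, loop-free digraph whose arcs
  are pairs of vertices. An undirected edge corresponds to two opposite arcs, so the degree of a
  vertex is its out-degree.
\<close>

text \<open>The null graph has average degree \<open>0 / 0 = 0\<close>.\<close>

definition average_degree :: "'a pair_pre_digraph \<Rightarrow> real" where
  "average_degree H =
     (\<Sum>v\<in>pverts H. real (out_degree (with_proj H) v)) / real (card (pverts H))"

text \<open>
  The predicate \<open>subgraph\<close> also admits subdigraphs that are not symmetric, so
  \<open>pair_graph H\<close> is required explicitly. Admitting the null graph does not affect the maximum
  for a non-null \<open>G\<close>, since average degrees are non-negative; it gives the null graph
  maximum average degree \<open>0\<close>.
\<close>

definition mad :: "'a pair_pre_digraph \<Rightarrow> real" where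
  "mad G = Max {average_degree H | H. pair_graph H \<and> subgraph (with_proj H) (with_proj G)}"

definition monochromatic_subgraph ::
    "'a pair_pre_digraph \<Rightarrow> ('a \<Rightarrow> 'c) \<Rightarrow> 'a pair_pre_digraph" where
  "monochromatic_subgraph G f =
     \<lparr> pverts = pverts G, parcs = {(u, v) \<in> parcs G. f u = f v} \<rparr>"

definition has_defect :: "'a pair_pre_digraph \<Rightarrow> ('a \<Rightarrow> 'c) \<Rightarrow> nat \<Rightarrow> bool" where
  "has_defect G f d \<longleftrightarrow>
     (\<forall>v\<in>pverts G. out_degree (with_proj (monochromatic_subgraph G f)) v \<le> d)"

text \<open>In a symmetric digraph the strongly connected components are the connected components.\<close>

definition has_clustering :: "'a pair_pre_digraph \<Rightarrow> ('a \<Rightarrow> 'c) \<Rightarrow> nat \<Rightarrow> bool" where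
  "has_clustering G f c \<longleftrightarrow>
     (\<forall>C \<in> pre_digraph.sccs (with_proj (monochromatic_subgraph G f)). card (verts C) \<le> c)"

text \<open>Lists may be infinite, in which case \<open>card\<close> would be \<open>0\<close>.\<close>

definition list_assignment :: "'a pair_pre_digraph \<Rightarrow> nat \<Rightarrow> ('a \<Rightarrow> 'c set) \<Rightarrow> bool" where
  "list_assignment G k L \<longleftrightarrow> (\<forall>v\<in>pverts G. infinite (L v) \<or> k \<le> card (L v))"

definition list_colouring :: "'a pair_pre_digraph \<Rightarrow> ('a \<Rightarrow> 'c set) \<Rightarrow> ('a \<Rightarrow> 'c) \<Rightarrow> bool" where
  "list_colouring G L f \<longleftrightarrow> (\<forall>v\<in>pverts G. f v \<in> L v)"

text \<open>
  HOL cannot quantify over types inside a definition, so the type of colours \<open>'c\<close> is an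
  explicit parameter; results are to be stated for an arbitrary \<open>'c\<close>.
\<close>

definition choosable_with_defect ::
    "'c itself \<Rightarrow> 'a pair_pre_digraph \<Rightarrow> nat \<Rightarrow> nat \<Rightarrow> bool" where
  "choosable_with_defect colour_type G k d \<longleftrightarrow>
     (\<forall>L :: 'a \<Rightarrow> 'c set. list_assignment G k L \<longrightarrow>
        (\<exists>f. list_colouring G L f \<and> has_defect G f d))"

definition choosable_with_clustering ::
    "'c itself \<Rightarrow> 'a pair_pre_digraph \<Rightarrow> nat \<Rightarrow> nat \<Rightarrow> bool" where
  "choosable_with_clustering colour_type G k c \<longleftrightarrow>
     (\<forall>L :: 'a \<Rightarrow> 'c set. list_assignment G k L \<longrightarrow>
        (\<exists>f. list_colouring G L f \<and> has_clustering G f c))"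

end

theory Submission
  imports Defs
begin

text \<open>
  Write \<open>deg\<^bsub>S\<^esub> v\<close> for the number of neighbours of \<open>v\<close> in \<open>S\<close>. Suppose that some non-empty
  \<open>A \<subseteq> X\<close> satisfies \<open>deg\<^bsub>A\<^esub> v + (d + 1) deg\<^bsub>X - A\<^esub> v < (d + 1) k\<close> for all \<open>v \<in> A\<close>. Colour \<open>X - A\<close>
  by induction and delete from each list on \<open>A\<close> the colours of the neighbours in \<open>X - A\<close>; a
  colouring of \<open>A\<close> from the remaining lists with the fewest monochromatic edges has defect \<open>d\<close>,
  since otherwise recolouring one vertex would improve it. If there is no such \<open>A\<close>, then the
  vertices of \<open>X\<close> can be removed one at a time such that each violates the inequality at its
  removal. Every edge of \<open>X\<close> is then counted once at one end and \<open>d + 1\<close> times at the other, so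
  \<open>(d + 2) |E(X)| \<ge> (d + 1) k |X|\<close>, i.e. \<open>X\<close> has average degree at least \<open>2 (d + 1) k / (d + 2)\<close>.
  For \<open>d = 1\<close> this is \<open>4 k / 3\<close>.
\<close>

section \<open>Degree counts within vertex sets\<close>

definition degree_in :: "('a \<times> 'a) set \<Rightarrow> 'a set \<Rightarrow> 'a \<Rightarrow> nat" where
  "degree_in E S v = card (S \<inter> E `` {v})"

text \<open>For symmetric irreflexive \<open>E\<close> this is twice the number of edges inside
  \<open>S\<close>; the doubled count avoids halving and explains the factors 2 in the bounds
  below.\<close>

definition degree_sum :: "('a \<times> 'a) set \<Rightarrow> 'a set \<Rightarrow> nat" where
  "degree_sum E S = (\<Sum>v\<in>S. degree_in E S v)"

text \<open>A bare relation, so that \<open>degree_in\<close> and \<open>degree_sum\<close> apply to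
  it on any vertex set.\<close>

definition mono_arcs :: "('a \<times> 'a) set \<Rightarrow> ('a \<Rightarrow> 'c) \<Rightarrow> ('a \<times> 'a) set" where
  "mono_arcs E f = {(u, v) \<in> E. f u = f v}"

lemma sym_mono_arcs: "sym E \<Longrightarrow> sym (mono_arcs E f)"
  by (auto simp: sym_def mono_arcs_def)

lemma irrefl_mono_arcs: "irrefl E \<Longrightarrow> irrefl (mono_arcs E f)"
  by (auto simp: irrefl_def mono_arcs_def)

lemma degree_in_Un:
  assumes "finite S" "finite T" "S \<inter> T = {}"
  shows "degree_in E (S \<union> T) v = degree_in E S v + degree_in E T v"
proof -
  have "(S \<union> T) \<inter> E `` {v} = S \<inter> E `` {v} \<union> T \<inter> E `` {v}" by blast
  then show ?thesis
    unfolding degree_in_def using assms by (simp add: card_Un_disjoint disjoint_iff)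
qed

lemma degree_in_mono_arcs_cong:
  assumes "\<And>u. u \<in> insert v S \<Longrightarrow> f u = g u"
  shows "degree_in (mono_arcs E f) S v = degree_in (mono_arcs E g) S v"
proof -
  have "S \<inter> mono_arcs E f `` {v} = S \<inter> mono_arcs E g `` {v}"
    using assms by (auto simp: mono_arcs_def)
  then show ?thesis by (simp add: degree_in_def)
qed

text \<open>Each edge between \<open>v\<close> and \<open>S\<close> contributes once at
  \<open>v\<close> and, by symmetry, once at its end in \<open>S\<close>; irreflexivity excludes a
  loop at \<open>v\<close>.\<close>

lemma degree_sum_insert:
  assumes "finite S" "v \<notin> S" "sym E" "irrefl E"
  shows "degree_sum E (insert v S) = degree_sum E S + 2 * degree_in E S v"
proof -
  have split: "degree_in E (insert v S) u = degree_in E S u + (if (u, v) \<in> E then 1 else 0)" for u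
  proof -
    have "degree_in E (S \<union> {v}) u = degree_in E S u + degree_in E {v} u"
      using assms by (intro degree_in_Un) auto
    moreover have "degree_in E {v} u = (if (u, v) \<in> E then 1 else 0)"
      by (auto simp: degree_in_def)
    ultimately show ?thesis by simp
  qed
  have "(\<Sum>u\<in>S. if (u, v) \<in> E then 1 else 0 :: nat) = card {u \<in> S. (u, v) \<in> E}"
    using assms(1) by (simp add: sum.If_cases Int_def)
  also have "{u \<in> S. (u, v) \<in> E} = S \<inter> E `` {v}"
    using \<open>sym E\<close> by (auto dest: symD)
  finally have "(\<Sum>u\<in>S. if (u, v) \<in> E then 1 else 0 :: nat) = degree_in E S v"
    by (simp add: degree_in_def)
  moreover have "(v, v) \<notin> E" using \<open>irrefl E\<close> by (simp add: irrefl_def)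
  ultimately show ?thesis
    using assms(1,2) by (simp add: degree_sum_def split sum.distrib)
qed

section \<open>Colouring by local improvement\<close>

lemma exists_colour_with_few_neighbours:
  assumes "finite N" "finite M" "card N < Suc d * card M"
  shows "\<exists>c\<in>M. card {u \<in> N. f u = c} \<le> d"
proof (rule ccontr)
  assume "\<not> ?thesis"
  then have "Suc d \<le> card {u \<in> N. f u = c}" if "c \<in> M" for c
    using that by (simp add: not_le Suc_le_eq)
  \<comment> \<open>Pigeonhole: the colour classes are disjoint subsets of \<open>N\<close>, so
    their sizes add up to at most \<open>card N\<close>.\<close>
  then have "Suc d * card M \<le> (\<Sum>c\<in>M. card {u \<in> N. f u = c})"
    using sum_bounded_below[of M "Suc d" "\<lambda>c. card {u \<in> N. f u = c}"] by (simp add: mult.commute)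
  also have "\<dots> = card (\<Union>c\<in>M. {u \<in> N. f u = c})"
    using assms by (subst card_UN_disjoint) auto
  also have "\<dots> \<le> card N"
    using assms(1) by (intro card_mono) auto
  finally show False using assms(3) by simp
qed

lemma list_colouring_of_large_lists:
  fixes M :: "'a \<Rightarrow> 'c set"
  assumes "finite A" "sym E" "irrefl E" and fin: "\<And>v. v \<in> A \<Longrightarrow> finite (M v)"
    and large: "\<And>v. v \<in> A \<Longrightarrow> degree_in E A v < Suc d * card (M v)"
  shows "\<exists>f. \<forall>v\<in>A. f v \<in> M v \<and> degree_in (mono_arcs E f) A v \<le> d"
proof -
  define P where "P f \<longleftrightarrow> (\<forall>v\<in>A. f v \<in> M v)" for f
  have "P (\<lambda>v. SOME c. c \<in> M v)"
    unfolding P_def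
  proof
    fix v assume "v \<in> A"
    then have "M v \<noteq> {}" using large by force
    then show "(SOME c. c \<in> M v) \<in> M v" by (simp add: some_in_eq)
  qed
  then obtain f where f: "P f"
    and least: "\<And>g. P g \<Longrightarrow> degree_sum (mono_arcs E f) A \<le> degree_sum (mono_arcs E g) A"
    using ex_has_least_nat[of P _ "\<lambda>f. degree_sum (mono_arcs E f) A"] by blast
  have "degree_in (mono_arcs E f) A v \<le> d" if v: "v \<in> A" for v
  proof (rule ccontr)
    assume bad: "\<not> ?thesis"
    \<comment> \<open>Recolouring \<open>v\<close> leaves \<open>degree_sum\<close> on
      \<open>B\<close> unchanged, so by \<open>degree_sum_insert\<close> only the monochromatic
      degree of \<open>v\<close> into \<open>B\<close> decides the comparison.\<close>
    define B where "B = A - {v}"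
    have B: "A = insert v B" "v \<notin> B" "finite B"
      using v \<open>finite A\<close> by (auto simp: B_def)
    have "card (A \<inter> E `` {v}) < Suc d * card (M v)"
      using large[OF v] by (simp add: degree_in_def)
    then obtain c where c: "c \<in> M v" "card {u \<in> A \<inter> E `` {v}. f u = c} \<le> d"
      using exists_colour_with_few_neighbours[OF _ fin[OF v]] \<open>finite A\<close> by blast
    define g where "g = f(v := c)"
    have "P g" using f c(1) by (auto simp: P_def g_def)
    have "degree_in (mono_arcs E g) B v \<le> card {u \<in> A \<inter> E `` {v}. f u = c}"
      unfolding degree_in_def using \<open>finite A\<close> B
      by (intro card_mono) (auto simp: mono_arcs_def g_def)
    moreover have "degree_in (mono_arcs E f) B v = degree_in (mono_arcs E f) A v"
    proof -
      have "A \<inter> mono_arcs E f `` {v} = B \<inter> mono_arcs E f `` {v}"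
        using \<open>irrefl E\<close> B(1) by (auto simp: mono_arcs_def irrefl_def)
      then show ?thesis by (simp add: degree_in_def)
    qed
    ultimately have "degree_in (mono_arcs E g) B v < degree_in (mono_arcs E f) B v"
      using bad c(2) by simp
    moreover have "degree_sum (mono_arcs E g) B = degree_sum (mono_arcs E f) B"
      unfolding degree_sum_def using B(2)
      by (intro sum.cong degree_in_mono_arcs_cong) (auto simp: g_def)
    ultimately have "degree_sum (mono_arcs E g) A < degree_sum (mono_arcs E f) A"
      using B \<open>sym E\<close> \<open>irrefl E\<close>
      by (simp add: degree_sum_insert sym_mono_arcs irrefl_mono_arcs)
    then show False using least[OF \<open>P g\<close>] by simp
  qed
  then show ?thesis using f by (auto simp: P_def)
qed

section \<open>Reducible subsets and the induction\<close>

lemma sparse_imp_reducible_subset: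
  assumes "finite X" "sym E" "irrefl E"
    and sparse: "(d + 2) * degree_sum E X < 2 * Suc d * k * card X"
  shows "\<exists>A\<subseteq>X. A \<noteq> {} \<and> (\<forall>v\<in>A. degree_in E A v + Suc d * degree_in E (X - A) v < Suc d * k)"
proof (rule ccontr)
  assume no: "\<not> ?thesis"
  \<comment> \<open>Here \<open>X - A\<close> is the set of vertices already removed, and the claim
    bounds the total over those still in \<open>A\<close>. At \<open>A = X\<close> the term for
    \<open>X - A\<close> vanishes and the right-hand side becomes
    \<open>(d + 2) * degree_sum E X\<close>, contradicting \<open>sparse\<close>.\<close>
  have "2 * Suc d * k * card A + d * degree_sum E (X - A)
      \<le> 2 * (\<Sum>v\<in>A. degree_in E X v) + d * degree_sum E X" if "A \<subseteq> X" for A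
    using finite_subset[OF that \<open>finite X\<close>] that
  proof (induction A rule: finite_psubset_induct)
    case (psubset A)
    show ?case
    proof (cases "A = {}")
      case False
      then obtain v where v: "v \<in> A"
        and "Suc d * k \<le> degree_in E A v + Suc d * degree_in E (X - A) v"
        using no psubset.prems by (meson not_le)
      moreover have "degree_in E X v = degree_in E A v + degree_in E (X - A) v"
        using degree_in_Un[of A "X - A" E v] psubset.prems psubset.hyps \<open>finite X\<close>
        by (simp add: Un_absorb1)
      \<comment> \<open>Twice the last term is exactly the growth of
        \<open>d * degree_sum E (X - A)\<close> when \<open>v\<close> moves to the removed
        side.\<close>
      ultimately have step: "Suc d * k \<le> degree_in E X v + d * degree_in E (X - A) v"
        by simp
      define B where "B = A - {v}"
      have B: "A = insert v B" "v \<notin> B" "finite B" "B \<subset> A" "X - B = insert v (X - A)"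
        using v psubset.hyps psubset.prems by (auto simp: B_def)
      have "degree_sum E (X - B) = degree_sum E (X - A) + 2 * degree_in E (X - A) v"
        unfolding B(5) using v \<open>finite X\<close> assms by (intro degree_sum_insert) auto
      moreover have "2 * Suc d * k * card B + d * degree_sum E (X - B)
          \<le> 2 * (\<Sum>v\<in>B. degree_in E X v) + d * degree_sum E X"
        using psubset.IH[OF B(4)] B(4) psubset.prems by blast
      moreover have "card A = Suc (card B)"
        "(\<Sum>v\<in>A. degree_in E X v) = degree_in E X v + (\<Sum>v\<in>B. degree_in E X v)"
        using B(1-3) by simp_all
      ultimately show ?thesis
        using step by (simp add: algebra_simps)
    qed simp
  qed
  from this[of X] have "2 * Suc d * k * card X \<le> (d + 2) * degree_sum E X"
    by (simp add: degree_sum_def algebra_simps)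
  then show False using sparse by simp
qed

text \<open>Sparsity is assumed for all subsets because the induction passes to
  \<open>X - A\<close>; for the empty set the strict inequality would read 0 < 0.\<close>

theorem sparse_imp_list_colouring:
  fixes L :: "'a \<Rightarrow> 'c set"
  assumes "finite X" "sym E" "irrefl E"
    and fin: "\<And>v. v \<in> X \<Longrightarrow> finite (L v)" and lists: "\<And>v. v \<in> X \<Longrightarrow> k \<le> card (L v)"
    and sparse: "\<And>Y. Y \<subseteq> X \<Longrightarrow> Y \<noteq> {} \<Longrightarrow>
      (d + 2) * degree_sum E Y < 2 * Suc d * k * card Y"
  shows "\<exists>f. \<forall>v\<in>X. f v \<in> L v \<and> degree_in (mono_arcs E f) X v \<le> d"
  using assms(1) fin lists sparse
proof (induction X rule: finite_psubset_induct)
  case (psubset X)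
  show ?case
  proof (cases "X = {}")
    case False
    then have "(d + 2) * degree_sum E X < 2 * Suc d * k * card X"
      using psubset.prems(3) by blast
    from sparse_imp_reducible_subset[OF psubset.hyps \<open>sym E\<close> \<open>irrefl E\<close> this]
    obtain A where A: "A \<subseteq> X" "A \<noteq> {}"
      and reducible:
        "\<And>v. v \<in> A \<Longrightarrow> degree_in E A v + Suc d * degree_in E (X - A) v < Suc d * k"
      by blast
    define B where "B = X - A"
    have "B \<subset> X" using A by (auto simp: B_def)
    have X: "X = A \<union> B" "A \<inter> B = {}" "finite A" "finite B"
      using A psubset.hyps by (auto simp: B_def intro: finite_subset)
    have "\<exists>g. \<forall>v\<in>B. g v \<in> L v \<and> degree_in (mono_arcs E g) B v \<le> d"
      using psubset.prems \<open>B \<subset> X\<close> by (intro psubset.IH) auto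
    then obtain g where g: "\<And>v. v \<in> B \<Longrightarrow> g v \<in> L v"
      "\<And>v. v \<in> B \<Longrightarrow> degree_in (mono_arcs E g) B v \<le> d"
      by blast
    define M where "M v = L v - g ` (B \<inter> E `` {v})" for v
    \<comment> \<open>A neighbour in \<open>B\<close> deletes at most one colour, which lowers
      \<open>Suc d * card (M v)\<close> by at most \<open>Suc d\<close>: hence the weight of
      \<open>degree_in E (X - A) v\<close> in \<open>reducible\<close>.\<close>
    have "degree_in E A v < Suc d * card (M v)" if "v \<in> A" for v
    proof -
      have "card (g ` (B \<inter> E `` {v})) \<le> degree_in E B v"
        unfolding degree_in_def using X by (intro card_image_le) auto
      moreover have "card (L v) - card (g ` (B \<inter> E `` {v})) \<le> card (M v)"
        unfolding M_def using X by (intro diff_card_le_card_Diff) auto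
      moreover have "k \<le> card (L v)" using psubset.prems(2) that A by blast
      ultimately have "k \<le> card (M v) + degree_in E B v" by linarith
      then have "Suc d * k \<le> Suc d * card (M v) + Suc d * degree_in E B v"
        by (metis add_mult_distrib2 mult_le_mono2)
      then show ?thesis using reducible[OF that] by (simp add: B_def)
    qed
    moreover have "finite (M v)" if "v \<in> A" for v
      using psubset.prems(1) that A by (auto simp: M_def)
    ultimately obtain f where f: "\<And>v. v \<in> A \<Longrightarrow> f v \<in> M v"
      "\<And>v. v \<in> A \<Longrightarrow> degree_in (mono_arcs E f) A v \<le> d"
      using list_colouring_of_large_lists[OF \<open>finite A\<close> \<open>sym E\<close> \<open>irrefl E\<close>, of M d] by blast
    define h where "h v = (if v \<in> A then f v else g v)" for v
    \<comment> \<open>No monochromatic arc joins \<open>A\<close> and \<open>B\<close>, so gluing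
      \<open>f\<close> and \<open>g\<close> does not add their defects.\<close>
    have no_cross: "(u, v) \<notin> mono_arcs E h \<and> (v, u) \<notin> mono_arcs E h" if "u \<in> A" "v \<in> B" for u v
    proof -
      have "f u \<noteq> g v" if "(u, v) \<in> E"
        using f(1)[OF \<open>u \<in> A\<close>] \<open>v \<in> B\<close> that by (auto simp: M_def)
      moreover have "(v, u) \<in> E \<longleftrightarrow> (u, v) \<in> E"
        using \<open>sym E\<close> by (auto dest: symD)
      ultimately show ?thesis
        using that X(2) by (auto simp: mono_arcs_def h_def)
    qed
    have "h v \<in> L v \<and> degree_in (mono_arcs E h) X v \<le> d" if "v \<in> X" for v
    proof (cases "v \<in> A")
      case True
      have "degree_in (mono_arcs E h) X v = degree_in (mono_arcs E h) A v"
        unfolding degree_in_def using no_cross True X(1)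
        by (intro arg_cong[where f = card]) auto
      also have "\<dots> = degree_in (mono_arcs E f) A v"
        using True by (intro degree_in_mono_arcs_cong) (auto simp: h_def)
      finally show ?thesis using f True by (simp add: h_def M_def)
    next
      case False
      then have "v \<in> B" using that X by blast
      have "degree_in (mono_arcs E h) X v = degree_in (mono_arcs E h) B v"
        unfolding degree_in_def using no_cross \<open>v \<in> B\<close> X(1)
        by (intro arg_cong[where f = card]) auto
      also have "\<dots> = degree_in (mono_arcs E g) B v"
        using \<open>v \<in> B\<close> X(2) by (intro degree_in_mono_arcs_cong) (auto simp: h_def)
      finally show ?thesis using g \<open>v \<in> B\<close> False by (simp add: h_def)
    qed
    then show ?thesis by blast
  qed simp
qed

section \<open>Maximum average degree and choosability\<close>

lemma out_degree_with_proj: "out_degree (with_proj H) v = card (parcs H `` {v})"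
proof -
  have "out_arcs (with_proj H) v = Pair v ` (parcs H `` {v})"
    by (auto simp: out_arcs_def)
  then show ?thesis
    by (simp add: out_degree_def card_image inj_on_def)
qed

text \<open>\<open>Max\<close> bounds the members of a finite set; finiteness holds because a
  subgraph is determined by its vertex and arc sets, which are subsets of those of
  \<open>G\<close>.\<close>

lemma average_degree_le_mad:
  assumes "pair_graph G" "pair_graph H" "subgraph (with_proj H) (with_proj G)"
  shows "average_degree H \<le> mad G"
proof -
  interpret pair_graph G by fact
  let ?S = "{H. pair_graph H \<and> subgraph (with_proj H) (with_proj G)}"
  have "?S \<subseteq> (\<lambda>(V, E). \<lparr>pverts = V, parcs = E\<rparr>) ` (Pow (pverts G) \<times> Pow (parcs G))"
  proof
    fix H assume "H \<in> ?S"
    then have "(pverts H, parcs H) \<in> Pow (pverts G) \<times> Pow (parcs G)"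
      by (auto simp: subgraph_def)
    then show "H \<in> (\<lambda>(V, E). \<lparr>pverts = V, parcs = E\<rparr>) ` (Pow (pverts G) \<times> Pow (parcs G))"
      by (rule rev_image_eqI) simp
  qed
  then have "finite ?S"
    by (rule finite_subset) simp
  then have "finite (average_degree ` ?S)" by simp
  also have "average_degree ` ?S =
      {average_degree H | H. pair_graph H \<and> subgraph (with_proj H) (with_proj G)}" by blast
  finally show ?thesis
    unfolding mad_def using assms(2,3) by (intro Max_ge) auto
qed

lemma degree_sum_le_mad:
  assumes "pair_graph G" "Y \<subseteq> pverts G"
  shows "real (degree_sum (parcs G) Y) \<le> mad G * real (card Y)"
proof (cases "Y = {}")
  case False
  interpret pair_graph G by fact
  \<comment> \<open>The induced subgraph on \<open>Y\<close> has average degree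
    \<open>degree_sum (parcs G) Y / card Y\<close>.\<close>
  define H where "H = \<lparr>pverts = Y, parcs = parcs G \<inter> Y \<times> Y\<rparr>"
  have "finite Y" using assms(2) by (rule finite_subset) simp
  have "symmetric (with_proj H)"
    using sym_arcs by (auto simp: H_def symmetric_def intro!: symI dest: symD)
  then have H: "pair_graph H"
    using \<open>finite Y\<close> pair_no_loops by unfold_locales (auto simp: H_def)
  then interpret H: pair_graph H .
  have "subgraph (with_proj H) (with_proj G)"
    using assms(2) wf_digraph H.wf_digraph by (auto simp: subgraph_def compatible_def H_def)
  then have "average_degree H \<le> mad G"
    by (intro average_degree_le_mad assms(1) H)
  moreover have "average_degree H = real (degree_sum (parcs G) Y) / real (card Y)"
  proof -
    have "parcs H `` {v} = Y \<inter> parcs G `` {v}" if "v \<in> Y" for v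
      using that by (auto simp: H_def)
    then show ?thesis
      by (simp add: average_degree_def out_degree_with_proj degree_sum_def degree_in_def)
        (simp add: H_def)
  qed
  ultimately show ?thesis
    using False \<open>finite Y\<close> by (simp add: divide_le_eq card_gt_0_iff)
qed (simp add: degree_sum_def)

text \<open>The hypothesis is mad(G) < 2 (d + 1) k / (d + 2), cleared of its denominator.\<close>

lemma choosable_with_defect_if_mad_less:
  assumes "pair_graph G" and mad: "(real d + 2) * mad G < 2 * (real d + 1) * real k"
  shows "choosable_with_defect TYPE('c) G k d"
  unfolding choosable_with_defect_def
proof (intro allI impI)
  interpret pair_graph G by fact
  fix L :: "'a \<Rightarrow> 'c set"
  assume L: "list_assignment G k L"
  \<comment> \<open>Lists may be infinite, so each is first cut down to a finite sublist with at
    least \<open>k\<close> colours.\<close>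
  have "\<exists>S. S \<subseteq> L v \<and> finite S \<and> k \<le> card S" if "v \<in> pverts G" for v
  proof (cases "finite (L v)")
    case True
    then have "k \<le> card (L v)" using L that by (auto simp: list_assignment_def)
    with True show ?thesis by blast
  next
    case False
    then obtain S where "finite S" "card S = k" "S \<subseteq> L v"
      using infinite_arbitrarily_large by blast
    then show ?thesis by auto
  qed
  then obtain S where S: "\<And>v. v \<in> pverts G \<Longrightarrow> S v \<subseteq> L v \<and> finite (S v) \<and> k \<le> card (S v)"
    by metis
  have "sym (parcs G)"
    using sym_arcs by (simp add: symmetric_def)
  have "irrefl (parcs G)"
    using pair_no_loops by (force simp: irrefl_def)
  have "(d + 2) * degree_sum (parcs G) Y < 2 * Suc d * k * card Y"
    if "Y \<subseteq> pverts G" "Y \<noteq> {}" for Y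
  proof -
    have "finite Y" using that(1) by (rule finite_subset) simp
    then have "real (card Y) > 0" using that(2) by (simp add: card_gt_0_iff)
    have "(real d + 2) * real (degree_sum (parcs G) Y) \<le> (real d + 2) * (mad G * real (card Y))"
      using degree_sum_le_mad[OF assms(1) that(1)] by (intro mult_left_mono) auto
    also have "\<dots> < 2 * (real d + 1) * real k * real (card Y)"
      using mult_strict_right_mono[OF mad \<open>real (card Y) > 0\<close>] by (simp add: mult.assoc)
    finally have "real ((d + 2) * degree_sum (parcs G) Y) < real (2 * Suc d * k * card Y)"
      by (simp add: algebra_simps)
    then show ?thesis by (simp only: of_nat_less_iff)
  qed
  then obtain f where
    f: "\<forall>v\<in>pverts G. f v \<in> S v \<and> degree_in (mono_arcs (parcs G) f) (pverts G) v \<le> d"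
    using sparse_imp_list_colouring[of "pverts G" "parcs G" S k d]
      \<open>sym (parcs G)\<close> \<open>irrefl (parcs G)\<close> S by auto
  have "parcs (monochromatic_subgraph G f) `` {v} = pverts G \<inter> mono_arcs (parcs G) f `` {v}" for v
    by (auto simp: monochromatic_subgraph_def mono_arcs_def dest: in_arcsD2)
  then have "has_defect G f d"
    using f by (simp add: has_defect_def out_degree_with_proj degree_in_def)
  moreover have "list_colouring G L f"
    using f S by (auto simp: list_colouring_def)
  ultimately show "\<exists>f. list_colouring G L f \<and> has_defect G f d" by blast
qed

section \<open>From defect 1 to clustering 2\<close>

lemma has_clustering_if_has_defect_1:
  assumes "pair_graph G" "has_defect G f 1"
  shows "has_clustering G f 2"
  unfolding has_clustering_def
proof
  interpret pair_graph G by fact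
  define H where "H = monochromatic_subgraph G f"
  fix C
  assume "C \<in> pre_digraph.sccs (with_proj (monochromatic_subgraph G f))"
  then have C: "subgraph C (with_proj H)" "strongly_connected C"
    by (auto simp: pre_digraph.sccs_def H_def induced_imp_subgraph)
  then obtain u where u: "u \<in> verts C" by (auto simp: strongly_connected_def)
  have "parcs H \<subseteq> parcs G" "pverts H = pverts G"
    by (auto simp: H_def monochromatic_subgraph_def)
  have fin: "finite (parcs H `` {v})" for v
    using \<open>parcs H \<subseteq> parcs G\<close> pair_finite_arcs by (blast intro: finite_Image finite_subset)
  have deg: "card (parcs H `` {v}) \<le> 1" if "v \<in> pverts G" for v
    using assms(2) that by (simp add: has_defect_def out_degree_with_proj H_def)
  have unique: "w = w'" if "(v, w) \<in> parcs H" "(v, w') \<in> parcs H" for v w w'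
    using that deg[of v] in_arcsD1 \<open>parcs H \<subseteq> parcs G\<close> fin[of v]
    by (auto simp: card_le_Suc0_iff_eq)
  have sym: "(w, v) \<in> parcs H" if "(v, w) \<in> parcs H" for v w
    using that sym_arcs
    by (auto simp: H_def monochromatic_subgraph_def symmetric_def dest: symD)
  \<comment> \<open>A walk from \<open>u\<close> can only alternate between \<open>u\<close> and its
    unique neighbour, whose only neighbour is \<open>u\<close> again by symmetry.\<close>
  have "verts C \<subseteq> insert u (parcs H `` {u})"
  proof
    fix v assume "v \<in> verts C"
    then have "u \<rightarrow>\<^sup>*\<^bsub>C\<^esub> v" using C(2) u by (auto simp: strongly_connected_def)
    then have "u \<rightarrow>\<^sup>*\<^bsub>with_proj H\<^esub> v"
      using C(1) by (rule pre_digraph.reachable_mono)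
    then have "(u, v) \<in> (parcs H)\<^sup>*"
      by (simp add: reachable_def rtrancl_on_rtranclI)
    then show "v \<in> insert u (parcs H `` {u})"
      by induction (use unique sym in blast)+
  qed
  then have "card (verts C) \<le> card (insert u (parcs H `` {u}))"
    using fin by (intro card_mono) auto
  also have "\<dots> \<le> 2"
    using deg[of u] u C(1) \<open>pverts H = pverts G\<close> fin[of u]
    by (auto simp: subgraph_def card_insert_if)
  finally show "card (verts C) \<le> 2" .
qed

theorem theorem4:
  fixes G :: "'a pair_pre_digraph"
  assumes "pair_graph G"
  shows "choosable_with_defect TYPE('c) G (nat \<lfloor>3 / 4 * mad G + 1\<rfloor>) 1 \<and>
         choosable_with_clustering TYPE('c) G (nat \<lfloor>3 / 4 * mad G + 1\<rfloor>) 2"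
proof -
  let ?k = "nat \<lfloor>3 / 4 * mad G + 1\<rfloor>"
  \<comment> \<open>The floor of x + 1 exceeds x. With \<open>d = 1\<close> the criterion reads 3
    mad(G) < 4 k, which is this inequality.\<close>
  have "3 / 4 * mad G < real ?k" by linarith
  then have defect: "choosable_with_defect TYPE('c) G ?k 1"
    using assms by (intro choosable_with_defect_if_mad_less) auto
  then have "choosable_with_clustering TYPE('c) G ?k 2"
    unfolding choosable_with_defect_def choosable_with_clustering_def
    using has_clustering_if_has_defect_1[OF assms] by blast
  with defect show ?thesis by blast
qed

end
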